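(* Let $n\ge 2$, $X=[0,1]$ and $p\in[0,1]$. The AverageOrRandomRank$-p$ mechanism satisfies Strong Proportionality in expectation, and it is strategyproof in expectation if and only if $p\in[0,\frac12]$.
   Context: Let $N=\{1,\dots,n\}$ be a set of agents, $n\ge 2$, and $X=[0,1]$. A location profile is $x=(x_1,\dots,x_n)\in X^n$, and $d(a,b)=|a-b|$. A randomized mechanism $f$ is a probability distribution over deterministic mechanisms $X^n\to X$. For $k\in\{1,\dots,n\}$ let $\operatorname{rank}^k(x)=\operatorname{med}(\underbrace{0,\dots,0}_{n-k},\underbrace{1,\dots,1}_{k-1},x_1,\dots,x_n)$. The Random Rank mechanism chooses $k$ uniformly at random from $\{1,\dots,n\}$ and outputs $\operatorname{rank}^k(x)$. The AverageOrRandomRank$-p$ mechanism places the facility at the average agent location $\frac1n\sum_{i=1}^n x_i$ with probability $p$, and at the output of the Random Rank mechanism with probability $1-p$. A randomized mechanism $f$ satisfies Strong Proportionality in expectation if for all $0\le\alpha<\beta\le 1$, every profile $x\in\{\alpha,\beta\}^n$ and every set $S\subseteq N$ of agents at the same location, $\mathbb{E}[d(x_i,f(x))]\le \frac{n-|S|}{n}(\beta-\alpha)$ for all $i\in S$. A randomized mechanism $f$ is strategyproof in expectation if for every agent $i\in N$, all $x_i,x_i'\in X$ and every profile $\hat x_{-i}$ of locations of the other agents, $\mathbb{E}[d(x_i,f(x_i,\hat x_{-i}))]\le\mathbb{E}[d(x_i,f(x_i',\hat x_{-i}))]$. *)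

theory Defs
  imports "HOL-Probability.Probability_Mass_Function" "HOL-Library.FuncSet"
begin

definition agents :: "nat \<Rightarrow> nat set" where
  "agents n = {1..n}"

(* Location profiles of the agents in A.  Being extensional, the elements of
   profiles (agents n) correspond one-to-one to the points of the cube [0,1]^n. *)
definition profiles :: "nat set \<Rightarrow> (nat \<Rightarrow> real) set" where
  "profiles A = (\<Pi>\<^sub>E i\<in>A. {0..1})"

type_synonym mechanism = "(nat \<Rightarrow> real) \<Rightarrow> real"

definition deterministic_mechanism :: "nat \<Rightarrow> mechanism \<Rightarrow> bool" where
  "deterministic_mechanism n g \<longleftrightarrow> g \<in> profiles (agents n) \<rightarrow> {0..1}"

definition randomized_mechanism :: "nat \<Rightarrow> mechanism pmf \<Rightarrow> bool" where
  "randomized_mechanism n f \<longleftrightarrow> (\<forall>g\<in>set_pmf f. deterministic_mechanism n g)"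

definition expected_dist :: "mechanism pmf \<Rightarrow> real \<Rightarrow> (nat \<Rightarrow> real) \<Rightarrow> real" where
  "expected_dist f a x = measure_pmf.expectation f (\<lambda>g. dist a (g x))"

(* Only applied to lists of odd length, where the median is the middle entry. *)
definition med :: "real list \<Rightarrow> real" where
  "med xs = sort xs ! (length xs div 2)"

definition rank :: "nat \<Rightarrow> nat \<Rightarrow> mechanism" where
  "rank n k x = med (replicate (n - k) 0 @ replicate (k - 1) 1 @ map x [1..<Suc n])"

definition average :: "nat \<Rightarrow> mechanism" where
  "average n x = (\<Sum>i\<in>agents n. x i) / real n"

definition random_rank :: "nat \<Rightarrow> mechanism pmf" where
  "random_rank n = map_pmf (rank n) (pmf_of_set {1..n})"

definition average_or_random_rank :: "nat \<Rightarrow> real \<Rightarrow> mechanism pmf" where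
  "average_or_random_rank n p =
     bind_pmf (bernoulli_pmf p) (\<lambda>b. if b then return_pmf (average n) else random_rank n)"

definition strongly_proportional_in_expectation :: "nat \<Rightarrow> mechanism pmf \<Rightarrow> bool" where
  "strongly_proportional_in_expectation n f \<longleftrightarrow>
     (\<forall>\<alpha> \<beta>. 0 \<le> \<alpha> \<and> \<alpha> < \<beta> \<and> \<beta> \<le> 1 \<longrightarrow>
       (\<forall>x \<in> agents n \<rightarrow>\<^sub>E {\<alpha>, \<beta>}. \<forall>S \<subseteq> agents n.
         (\<forall>i\<in>S. \<forall>j\<in>S. x i = x j) \<longrightarrow>
         (\<forall>i\<in>S. expected_dist f (x i) x \<le> (real n - real (card S)) / real n * (\<beta> - \<alpha>))))"

definition strategyproof_in_expectation :: "nat \<Rightarrow> mechanism pmf \<Rightarrow> bool" where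
  "strategyproof_in_expectation n f \<longleftrightarrow>
     (\<forall>i \<in> agents n. \<forall>a \<in> {0..1}. \<forall>a' \<in> {0..1}. \<forall>y \<in> profiles (agents n - {i}).
       expected_dist f a (y(i := a)) \<le> expected_dist f a (y(i := a')))"

lemma randomized_mechanism_average_or_random_rank:
  assumes "n \<ge> 1"
  shows "randomized_mechanism n (average_or_random_rank n p)"
proof -
  have "deterministic_mechanism n (average n)"
    unfolding deterministic_mechanism_def
  proof
    fix x assume "x \<in> profiles (agents n)"
    then have x: "0 \<le> x i \<and> x i \<le> 1" if "i \<in> agents n" for i
      using that by (auto simp: profiles_def dest: PiE_mem)
    have "0 \<le> (\<Sum>i\<in>agents n. x i)"
      using x by (intro sum_nonneg) auto
    moreover have "(\<Sum>i\<in>agents n. x i) \<le> real n"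
      using sum_bounded_above[of "agents n" x 1] x by (auto simp: agents_def)
    ultimately show "average n x \<in> {0..1}"
      using assms by (auto simp: average_def divide_simps)
  qed
  moreover have "deterministic_mechanism n (rank n k)" if "k \<in> {1..n}" for k
    unfolding deterministic_mechanism_def
  proof
    fix x assume x: "x \<in> profiles (agents n)"
    let ?l = "replicate (n - k) 0 @ replicate (k - 1) 1 @ map x [1..<Suc n]"
    have "sort ?l ! (length ?l div 2) \<in> set (sort ?l)"
      using assms by (intro nth_mem) simp
    moreover have "set ?l \<subseteq> {0..1}"
      using x by (auto simp: profiles_def agents_def PiE_iff set_replicate_conv_if)
    ultimately show "rank n k x \<in> {0..1}"
      unfolding rank_def med_def set_sort by (rule subsetD[rotated])
  qed
  ultimately have "deterministic_mechanism n g" if "g \<in> insert (average n) (rank n ` {1..n})" for g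
    using that by blast
  moreover have "set_pmf (average_or_random_rank n p) \<subseteq> insert (average n) (rank n ` {1..n})"
    using assms unfolding average_or_random_rank_def random_rank_def set_bind_pmf
    by (auto simp: set_pmf_of_set split: if_splits)
  ultimately show ?thesis
    unfolding randomized_mechanism_def by blast
qed

end

theory Submission
  imports Defs
begin

text \<open>
  On profiles in the unit cube, \<^term>\<open>rank n k\<close> is the \<open>k\<close>-th smallest location, so Random Rank
  induces the same lottery as Random Dictatorship. Hence the expected distance from \<open>a\<close> is
  \<open>p\<close> times the distance from \<open>a\<close> to the average plus \<open>1 - p\<close> times the average distance from \<open>a\<close>
  to the agents. The first distance is at most the second, which gives Strong Proportionality. A
  misreport from \<open>a\<close> to \<open>a'\<close> moves the average by \<open>\<bar>a - a'\<bar> / n\<close> and increases the average distance by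
  exactly the same amount, so it cannot pay off if \<open>p \<le> 1/2\<close>. It does pay off for \<open>p > 1/2\<close> whenever
  the average moves towards \<open>a\<close> without passing it.
\<close>

text \<open>In the unit interval 0 is least and 1 is greatest, so the padding ends up on the two
  sides of the sorted locations.\<close>

lemma sort_clamped:
  fixes xs :: "real list"
  assumes "set xs \<subseteq> {0..1}"
  shows "sort (replicate l 0 @ replicate m 1 @ xs) = replicate l 0 @ sort xs @ replicate m 1"
  using assms by (intro properties_for_sort) (auto simp: sorted_append)

lemma rank_eq_nth_sort:
  assumes "x \<in> agents n \<rightarrow> {0..1}" and "k < n"
  shows "rank n (Suc k) x = sort (map x [1..<Suc n]) ! k"
proof -
  have "set (map x [1..<Suc n]) \<subseteq> {0..1}"
    using assms(1) by (auto simp: agents_def)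
  then have "sort (replicate (n - Suc k) 0 @ replicate k 1 @ map x [1..<Suc n]) =
      replicate (n - Suc k) 0 @ sort (map x [1..<Suc n]) @ replicate k 1"
    by (rule sort_clamped)
  \<comment> \<open>The padded list has 2n - 1 entries, so its middle index is n - 1; past the
    \<open>n - Suc k\<close> leading zeros this is index \<open>k\<close> among the sorted
    locations.\<close>
  moreover have "(n - Suc k + (k + n)) div 2 = (n - Suc k) + k"
    using assms(2) by auto
  ultimately have "rank n (Suc k) x =
      (replicate (n - Suc k) 0 @ sort (map x [1..<Suc n]) @ replicate k 1) ! ((n - Suc k) + k)"
    by (simp only: rank_def med_def length_append length_replicate length_map length_upt diff_Suc_1)
  also have "\<dots> = (sort (map x [1..<Suc n]) @ replicate k 1) ! k"
    using nth_append_length_plus[of "replicate (n - Suc k) 0" _ k] by (simp only: length_replicate)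
  finally show ?thesis
    using assms(2) by (simp add: nth_append del: upt_Suc)
qed

text \<open>As \<open>k\<close> varies, the ranks run through the sorted locations, and sorting only
  permutes them. Later \<open>h\<close> is the distance from \<open>a\<close>.\<close>

lemma sum_rank:
  fixes h :: "real \<Rightarrow> real"
  assumes "x \<in> agents n \<rightarrow> {0..1}"
  shows "(\<Sum>k=1..n. h (rank n k x)) = (\<Sum>i\<in>agents n. h (x i))"
proof -
  let ?xs = "map x [1..<Suc n]"
  have "(\<Sum>k=1..n. h (rank n k x)) = (\<Sum>k<n. h (rank n (Suc k) x))"
    by (simp add: sum.atLeast1_atMost_eq)
  also have "\<dots> = (\<Sum>k<n. map h (sort ?xs) ! k)"
    using assms by (intro sum.cong) (auto simp: rank_eq_nth_sort simp del: upt_Suc)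
  also have "\<dots> = sum_list (map h (sort ?xs))"
    by (simp add: sum_list_sum_nth atLeast0LessThan del: upt_Suc)
  also have "\<dots> = sum_list (map h ?xs)"
    by (metis mset_map mset_sort sum_mset_sum_list)
  also have "\<dots> = (\<Sum>i\<in>agents n. h (x i))"
    by (simp add: interv_sum_list_conv_sum_set_nat agents_def atLeastLessThanSuc_atLeastAtMost
          o_def del: upt_Suc)
  finally show ?thesis .
qed

lemma expected_dist_average_or_random_rank:
  assumes "x \<in> agents n \<rightarrow> {0..1}" and "n \<ge> 1" and "p \<in> {0..1}"
  shows "expected_dist (average_or_random_rank n p) a x =
           p * \<bar>a - average n x\<bar> + (1 - p) * ((\<Sum>i\<in>agents n. \<bar>a - x i\<bar>) / real n)"
proof -
  have "measure_pmf.expectation (random_rank n) (\<lambda>g. dist a (g x)) =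
      (\<Sum>k=1..n. \<bar>a - rank n k x\<bar>) / real n"
    using assms(2) by (simp add: random_rank_def integral_pmf_of_set dist_real_def)
  also have "\<dots> = (\<Sum>i\<in>agents n. \<bar>a - x i\<bar>) / real n"
    by (simp only: sum_rank[OF assms(1), of "\<lambda>t. \<bar>a - t\<bar>"])
  finally have random_rank: "measure_pmf.expectation (random_rank n) (\<lambda>g. dist a (g x)) =
      (\<Sum>i\<in>agents n. \<bar>a - x i\<bar>) / real n" .
  \<comment> \<open>With finite supports, the expectation splits into a finite sum over the two
    outcomes of the coin.\<close>
  have "finite (set_pmf (random_rank n))"
    using assms(2) by (simp add: random_rank_def)
  then have "expected_dist (average_or_random_rank n p) a x =
      (\<Sum>b\<in>UNIV. pmf (bernoulli_pmf p) b *\<^sub>R measure_pmf.expectation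
        (if b then return_pmf (average n) else random_rank n) (\<lambda>g. dist a (g x)))"
    unfolding expected_dist_def average_or_random_rank_def
    by (intro pmf_expectation_bind) auto
  then show ?thesis
    using assms(3) by (simp add: UNIV_bool random_rank) (simp add: dist_real_def)
qed

text \<open>This is the triangle inequality: \<open>a - average n x\<close> is the mean of the
  differences \<open>a - x i\<close>.\<close>

lemma abs_diff_average_le:
  assumes "n \<ge> 1"
  shows "\<bar>a - average n x\<bar> \<le> (\<Sum>i\<in>agents n. \<bar>a - x i\<bar>) / real n"
proof -
  have "a - average n x = (\<Sum>i\<in>agents n. a - x i) / real n"
    using assms by (simp add: average_def agents_def sum_subtractf field_simps)
  then show ?thesis
    by (simp add: abs_divide divide_right_mono sum_abs)
qed

text \<open>\<open>h\<close> is left free to cover both the average (\<open>h\<close> the identity)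
  and the total distance from \<open>a\<close>.\<close>

lemma sum_agents_upd:
  fixes h :: "real \<Rightarrow> real"
  assumes "i \<in> agents n"
  shows "(\<Sum>j\<in>agents n. h ((y(i := b)) j)) = h b + (\<Sum>j\<in>agents n - {i}. h (y j))"
  using assms by (subst sum.remove[of _ i]) (auto simp: agents_def intro: sum.cong)

lemma average_upd_diff:
  assumes "i \<in> agents n"
  shows "average n (y(i := b)) - average n (y(i := c)) = (b - c) / real n"
  using sum_agents_upd[OF assms, of "\<lambda>t. t"]
  by (simp add: average_def diff_divide_distrib[symmetric] del: fun_upd_apply)

lemma expected_dist_upd_diff:
  assumes "i \<in> agents n" and "a \<in> {0..1}" and "a' \<in> {0..1}" and "y \<in> profiles (agents n - {i})"
    and "p \<in> {0..1}"
  shows "expected_dist (average_or_random_rank n p) a (y(i := a')) -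
           expected_dist (average_or_random_rank n p) a (y(i := a)) =
         p * (\<bar>a - average n (y(i := a'))\<bar> - \<bar>a - average n (y(i := a))\<bar>) +
           (1 - p) * (\<bar>a - a'\<bar> / real n)"
proof -
  have n: "n \<ge> 1"
    using assms(1) by (auto simp: agents_def)
  have cube: "y(i := b) \<in> agents n \<rightarrow> {0..1}" if "b \<in> {0..1}" for b
    using assms(4) that by (auto simp: profiles_def PiE_iff)
  \<comment> \<open>Here \<open>s\<close> is the total distance to the other agents, which cancels.
    A truthful agent contributes \<open>\<bar>a - a\<bar>\<close>, kept unsimplified to match the
    unfolded goal.\<close>
  have rearrange: "p * A' + (1 - p) * ((d + s) / N) - (p * A + (1 - p) * ((\<bar>a - a\<bar> + s) / N)) =
      p * (A' - A) + (1 - p) * (d / N)" for A A' d s N :: real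
    by (simp add: right_diff_distrib add_divide_distrib distrib_left)
  show ?thesis
    unfolding expected_dist_average_or_random_rank[OF cube[OF assms(2)] n assms(5)]
      expected_dist_average_or_random_rank[OF cube[OF assms(3)] n assms(5)]
      sum_agents_upd[OF assms(1), of "\<lambda>t. \<bar>a - t\<bar>"]
    by (rule rearrange)
qed

lemma strongly_proportional_average_or_random_rank:
  assumes "n \<ge> 1" and "p \<in> {0..1}"
  shows "strongly_proportional_in_expectation n (average_or_random_rank n p)"
  unfolding strongly_proportional_in_expectation_def
proof (intro allI impI ballI)
  fix \<alpha> \<beta> :: real and x S i
  assume ab: "0 \<le> \<alpha> \<and> \<alpha> < \<beta> \<and> \<beta> \<le> 1" and x: "x \<in> agents n \<rightarrow>\<^sub>E {\<alpha>, \<beta>}"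
    and S: "S \<subseteq> agents n" and same: "\<forall>i\<in>S. \<forall>j\<in>S. x i = x j" and i: "i \<in> S"
  let ?D = "(\<Sum>j\<in>agents n. \<bar>x i - x j\<bar>) / real n"
  have val: "x j = \<alpha> \<or> x j = \<beta>" if "j \<in> agents n" for j
    using x that by (auto dest: PiE_mem)
  have finS: "finite S"
    using S by (rule finite_subset) (simp add: agents_def)
  have cardS: "card S \<le> n"
    using S card_mono[of "agents n" S] by (simp add: agents_def)
  have cube: "x \<in> agents n \<rightarrow> {0..1}"
  proof
    fix j assume "j \<in> agents n"
    then show "x j \<in> {0..1}"
      using val[of j] ab by auto
  qed
  \<comment> \<open>Agents in \<open>S\<close> are at distance 0 from \<open>x i\<close>, so at most
    \<open>n - card S\<close> terms count, each at most \<beta> - \<alpha>.\<close>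
  have "(\<Sum>j\<in>agents n. \<bar>x i - x j\<bar>) = (\<Sum>j\<in>agents n - S. \<bar>x i - x j\<bar>)"
  proof (rule sum.mono_neutral_right)
    have "x i = x j" if "j \<in> S" for j
      using same i that by blast
    then show "\<forall>j\<in>agents n - (agents n - S). \<bar>x i - x j\<bar> = 0"
      by auto
  qed (auto simp: agents_def)
  also have "\<dots> \<le> real (card (agents n - S)) * (\<beta> - \<alpha>)"
  proof (rule sum_bounded_above)
    fix j assume "j \<in> agents n - S"
    then have "x i = \<alpha> \<or> x i = \<beta>" "x j = \<alpha> \<or> x j = \<beta>"
      using val i S by blast+
    then show "\<bar>x i - x j\<bar> \<le> \<beta> - \<alpha>"
      using ab by auto
  qed
  also have "card (agents n - S) = n - card S"
    using S finS by (simp add: card_Diff_subset agents_def)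
  finally have D: "?D \<le> (real n - real (card S)) / real n * (\<beta> - \<alpha>)"
    using cardS by (simp add: of_nat_diff divide_right_mono)
  have "expected_dist (average_or_random_rank n p) (x i) x =
      p * \<bar>x i - average n x\<bar> + (1 - p) * ?D"
    by (rule expected_dist_average_or_random_rank[OF cube assms])
  also have "\<dots> \<le> p * ?D + (1 - p) * ?D"
    using assms by (intro add_right_mono mult_left_mono abs_diff_average_le) auto
  also have "\<dots> = ?D"
    by (simp only: distrib_right[symmetric]) simp
  also note D
  finally show "expected_dist (average_or_random_rank n p) (x i) x
      \<le> (real n - real (card S)) / real n * (\<beta> - \<alpha>)" .
qed

lemma strategyproof_average_or_random_rank:
  assumes "p \<in> {0..1/2}"
  shows "strategyproof_in_expectation n (average_or_random_rank n p)"
  unfolding strategyproof_in_expectation_def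
proof (intro ballI)
  fix i y and a a' :: real
  assume asm: "i \<in> agents n" "a \<in> {0..1}" "a' \<in> {0..1}" "y \<in> profiles (agents n - {i})"
  let ?\<delta> = "\<bar>a - a'\<bar> / real n"
  let ?gain = "\<bar>a - average n (y(i := a'))\<bar> - \<bar>a - average n (y(i := a))\<bar>"
  have "\<bar>average n (y(i := a)) - average n (y(i := a'))\<bar> = ?\<delta>"
    by (simp only: average_upd_diff[OF asm(1)] abs_divide abs_of_nat)
  then have "- ?\<delta> \<le> ?gain"
    by linarith
  then have "p * - ?\<delta> \<le> p * ?gain"
    using assms by (intro mult_left_mono) auto
  \<comment> \<open>Here p \<le> 1/2 enters, as p \<le> 1 - p: the certain loss under Random Rank
    covers the largest possible gain under the average.\<close>
  moreover have "p * ?\<delta> \<le> (1 - p) * ?\<delta>"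
    using assms by (intro mult_right_mono) auto
  moreover have "- (p * ?\<delta>) = p * - ?\<delta>"
    by simp
  moreover have "p \<in> {0..1}"
    using assms by auto
  ultimately show "expected_dist (average_or_random_rank n p) a (y(i := a))
      \<le> expected_dist (average_or_random_rank n p) a (y(i := a'))"
    using expected_dist_upd_diff[OF asm \<open>p \<in> {0..1}\<close>] by linarith
qed

lemma strategyproof_average_or_random_rankD:
  assumes "n \<ge> 2" and "p \<in> {0..1}"
    and "strategyproof_in_expectation n (average_or_random_rank n p)"
  shows "p \<le> 1/2"
proof -
  \<comment> \<open>With all other agents at 1, an agent at 1/2 who reports 0 moves the average closer to 1/2
    without passing it, since \<open>(n - 1) / n \<ge> 1/2\<close>.\<close>
  let ?y = "restrict (\<lambda>_. 1) (agents n - {1}) :: nat \<Rightarrow> real"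
  have asm: "1 \<in> agents n" "(1/2 :: real) \<in> {0..1}" "(0 :: real) \<in> {0..1}"
      "?y \<in> profiles (agents n - {1})"
    using assms(1) by (auto simp: agents_def profiles_def)
  have "(\<Sum>j\<in>agents n - {1}. ?y j) = real n - 1"
    using assms(1) by (simp add: agents_def)
  then have avg: "average n (?y(1 := b)) = (b + (real n - 1)) / real n" for b
    using sum_agents_upd[OF asm(1), of "\<lambda>t. t" ?y b] by (simp only: average_def)
  have "1/2 \<le> average n (?y(1 := 0))" "1/2 \<le> average n (?y(1 := 1/2))"
    unfolding avg using assms(1) by (simp_all add: field_simps)
  moreover have "average n (?y(1 := 0)) - average n (?y(1 := 1/2)) = - (1/2) / real n"
    by (simp only: average_upd_diff[OF asm(1)]) simp
  ultimately have gain: "\<bar>1/2 - average n (?y(1 := 0))\<bar> - \<bar>1/2 - average n (?y(1 := 1/2))\<bar>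
      = - (1/2) / real n"
    by linarith
  have "expected_dist (average_or_random_rank n p) (1/2) (?y(1 := 1/2))
      \<le> expected_dist (average_or_random_rank n p) (1/2) (?y(1 := 0))"
    using assms(3) asm unfolding strategyproof_in_expectation_def by blast
  \<comment> \<open>Multiplied by 2n, this inequality reads 0 \<le> 1 - 2p.\<close>
  then have "0 \<le> p * (- (1/2) / real n) + (1 - p) * (\<bar>1/2 - 0\<bar> / real n)"
    using expected_dist_upd_diff[OF asm assms(2)] unfolding gain by linarith
  then show ?thesis
    using assms(1) by (simp add: field_simps)
qed

theorem theorem5:
  fixes n :: nat and p :: real
  assumes "n \<ge> 2" and "p \<in> {0..1}"
  shows "strongly_proportional_in_expectation n (average_or_random_rank n p) \<and>
         (strategyproof_in_expectation n (average_or_random_rank n p) \<longleftrightarrow> p \<in> {0..1/2})"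
  using assms strongly_proportional_average_or_random_rank[of n p]
    strategyproof_average_or_random_rank[of p n] strategyproof_average_or_random_rankD[of n p]
  by auto

end
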